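(* Let $p(a,x)\in\mathbb R\langle a,x\rangle$ be a symmetric polynomial of degree $d_a$ in $a$ and degree $d_x\ge2$ in $x$, and let $Z(a,x)$ be the middle matrix of its partial Hessian $\frac{\partial^2}{\partial x^2}p(a,x)[h]$. There is a square matrix polynomial $A(a,x)$ such that $$Z(a,x)A(a,x)=Z(a,0).$$ Further, $A$ has a square root $B$, so that $B^2=A$, which is also a matrix polynomial and for which $$B^T(a,x)Z(a,x)B(a,x)=Z(a,0).$$ Further, $B$ is invertible and its inverse is a matrix polynomial. In particular, for every $n$ and every $(A,X)\in\mathbb S_n(\mathbb R^g\times\mathbb R^g)$, the matrix $B(A,X)$ is invertible.
   Context: Fix a positive integer $g$. $\mathbb R\langle a,x\rangle$ denotes the polynomials with real coefficients in the non-commuting variables $a=(a_1,\dots,a_g)$, $x=(x_1,\dots,x_g)$. The involution ${}^T$ is linear, reverses the order of words, and fixes each variable; $p$ is symmetric if $p^T=p$; for matrices of polynomials ${}^T$ is the matrix transpose combined with the involution entrywise. $\mathbb S_n(\mathbb R^g\times\mathbb R^g)$ is the set of pairs $(A,X)$ of $g$-tuples of real symmetric $n\times n$ matrices; (matrix) polynomials are evaluated by substitution (entrywise). The partial Hessian $\frac{\partial^2}{\partial x^2}p(a,x)[h]$, $h=(h_1,\dots,h_g)$ additional non-commuting symmetric variables, is the formal second derivative at $t=0$ of $t\mapsto p(a,x+th)$; it is homogeneous of degree two in $h$. Border vector and middle matrix: for $j=0,\dots,d_x-2$ let $V_j$ be the column vector whose entries are all words $h_km_0x_{k_1}m_1\cdots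 x_{k_j}m_j$ with $m_0,\dots,m_j$ words in $a$ of total degree at most $d_a$ (so degree exactly $j$ in $x$), and let the border vector $V(a,x)[h]$ be the stack of $V_0,\dots,V_{d_x-2}$. The middle matrix $Z(a,x)$ is the unique matrix of polynomials in $(a,x)$, with rows and columns indexed by the entries of $V$, such that $\frac{\partial^2}{\partial x^2}p(a,x)[h]=V(a,x)[h]^TZ(a,x)V(a,x)[h]$. $Z(a,0)$ is obtained from $Z(a,x)$ by setting $x=0$. *)

theory Defs
  imports
    "HOL-Library.Poly_Mapping"
    "HOL-Computational_Algebra.Polynomial"
    "Jordan_Normal_Form.Matrix"
begin

text \<open>Words form the free monoid under concatenation. Written additively, this makes the finitely
  supported maps from words to coefficients the free algebra, with the convolution product of
  \<^theory>\<open>HOL-Library.Poly_Mapping\<close>.\<close>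

instantiation list :: (type) monoid_add
begin

definition zero_list_def: "0 = ([] :: 'a list)"
definition plus_list_def: "xs + ys = (xs @ ys :: 'a list)"

instance by standard (simp_all add: zero_list_def plus_list_def)

end

type_synonym ('v, 'r) ncpoly = "'v list \<Rightarrow>\<^sub>0 'r"

text \<open>The index type \<open>'g\<close> (a finite type in the theorem, with \<open>g = CARD('g)\<close>) numbers the variables
  \<open>a\<^sub>1, \<dots>, a\<^sub>g\<close> and \<open>x\<^sub>1, \<dots>, x\<^sub>g\<close>; the second type adjoins \<open>h\<^sub>1, \<dots>, h\<^sub>g\<close>.\<close>

datatype 'g ax = A_var 'g | X_var 'g
datatype 'g axh = AX_var "'g ax" | H_var 'g

fun is_a :: "'g ax \<Rightarrow> bool" where
  "is_a (A_var k) = True"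
| "is_a (X_var k) = False"

fun is_x :: "'g ax \<Rightarrow> bool" where
  "is_x (A_var k) = False"
| "is_x (X_var k) = True"

definition nc_monom :: "'v list \<Rightarrow> ('v, 'r::{zero,one}) ncpoly" where
  "nc_monom w = Poly_Mapping.single w 1"

definition nc_const :: "'r \<Rightarrow> ('v, 'r::zero) ncpoly" where
  "nc_const c = Poly_Mapping.single [] c"

definition nc_var :: "'v \<Rightarrow> ('v, 'r::{zero,one}) ncpoly" where
  "nc_var v = nc_monom [v]"

definition nc_star :: "('v, 'r::zero) ncpoly \<Rightarrow> ('v, 'r) ncpoly" where
  "nc_star = Poly_Mapping.map_key rev"

definition nc_symmetric :: "('v, 'r::zero) ncpoly \<Rightarrow> bool" where
  "nc_symmetric p \<longleftrightarrow> nc_star p = p"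

text \<open>Degree in the variables satisfying \<open>P\<close>; the zero polynomial has degree 0.\<close>

definition nc_degree :: "('v \<Rightarrow> bool) \<Rightarrow> ('v, 'r::zero) ncpoly \<Rightarrow> nat" where
  "nc_degree P p = Max (insert 0 ((\<lambda>w. length (filter P w)) ` Poly_Mapping.keys p))"

text \<open>Substitution of \<open>\<sigma> v\<close> for each variable \<open>v\<close>, with coefficients mapped by \<open>\<phi>\<close>.\<close>

definition nc_subst ::
  "('r::zero \<Rightarrow> 's::semiring_1) \<Rightarrow> ('v \<Rightarrow> 's) \<Rightarrow> ('v, 'r) ncpoly \<Rightarrow> 's" where
  "nc_subst \<phi> \<sigma> p =
     (\<Sum>w\<in>Poly_Mapping.keys p. \<phi> (Poly_Mapping.lookup p w) * prod_list (map \<sigma> w))"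

definition embed_ax :: "('g ax, real) ncpoly \<Rightarrow> ('g axh, real) ncpoly" where
  "embed_ax = nc_subst nc_const (\<lambda>v. nc_var (AX_var v))"

definition x_zero :: "('g ax, real) ncpoly \<Rightarrow> ('g ax, real) ncpoly" where
  "x_zero = nc_subst nc_const (\<lambda>v. if is_x v then 0 else nc_var v)"

text \<open>\<open>p(a, x + t h)\<close> lives in \<open>\<real>[t]\<langle>a,x,h\<rangle>\<close>: the coefficients are real polynomials in the central
  indeterminate \<open>t\<close>, which is \<open>[:0, 1:]\<close>.\<close>

fun shift_var :: "'g ax \<Rightarrow> ('g axh, real poly) ncpoly" where
  "shift_var (A_var k) = nc_var (AX_var (A_var k))"
| "shift_var (X_var k) = nc_var (AX_var (X_var k)) + nc_const [:0, 1:] * nc_var (H_var k)"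

definition x_shift :: "('g ax, real) ncpoly \<Rightarrow> ('g axh, real poly) ncpoly" where
  "x_shift = nc_subst (\<lambda>c. nc_const [:c:]) shift_var"

definition partial_hessian :: "('g ax, real) ncpoly \<Rightarrow> ('g axh, real) ncpoly" where
  "partial_hessian p = Poly_Mapping.map (\<lambda>c. poly (pderiv (pderiv c)) 0) (x_shift p)"

text \<open>The words \<open>h\<^sub>k m\<^sub>0 x\<^bsub>k(1)\<^esub> m\<^sub>1 \<dots> x\<^bsub>k(j)\<^esub> m\<^sub>j\<close>; the list \<open>kms\<close> holds the pairs
  \<open>(k(i), m\<^sub>i)\<close>, \<open>1 \<le> i \<le> j\<close>.\<close>

definition border_word :: "'g \<Rightarrow> 'g list \<Rightarrow> ('g \<times> 'g list) list \<Rightarrow> 'g axh list" where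
  "border_word k m0 kms =
     H_var k # map AX_var (map A_var m0 @ concat (map (\<lambda>(i, m). X_var i # map A_var m) kms))"

definition border_words :: "nat \<Rightarrow> nat \<Rightarrow> 'g axh list set" where
  "border_words da j = {border_word k m0 kms | k m0 kms.
     length kms = j \<and> length m0 + (\<Sum>(i, m)\<leftarrow>kms. length m) \<le> da}"

text \<open>\<open>ws\<close> lists the entries of the border vector: the blocks \<open>V\<^sub>0, \<dots>, V\<^bsub>dx-2\<^esub>\<close> stacked in this
  order, each word occurring once and in an arbitrary order within its block.\<close>

definition is_border :: "nat \<Rightarrow> nat \<Rightarrow> 'g axh list list \<Rightarrow> bool" where
  "is_border da dx ws \<longleftrightarrow> (\<exists>Vs. length Vs = dx - 1 \<and>
     (\<forall>j < dx - 1. distinct (Vs ! j) \<and> set (Vs ! j) = border_words da j) \<and> ws = concat Vs)"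

definition border_vector :: "'g axh list list \<Rightarrow> ('g axh, real) ncpoly mat" where
  "border_vector ws = mat (length ws) 1 (\<lambda>(i, _). nc_monom (ws ! i))"

definition mat_star :: "('v, 'r::zero) ncpoly mat \<Rightarrow> ('v, 'r) ncpoly mat" where
  "mat_star M = map_mat nc_star (transpose_mat M)"

definition middle_matrix ::
  "'g axh list list \<Rightarrow> ('g ax, real) ncpoly \<Rightarrow> ('g ax, real) ncpoly mat" where
  "middle_matrix ws p = (THE Z. Z \<in> carrier_mat (length ws) (length ws) \<and>
     mat 1 1 (\<lambda>_. partial_hessian p) =
       mat_star (border_vector ws) * map_mat embed_ax Z * border_vector ws)"

definition sym_tuples :: "nat \<Rightarrow> (('g \<Rightarrow> real mat) \<times> ('g \<Rightarrow> real mat)) set" where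
  "sym_tuples n = {(a, x). \<forall>k.
     a k \<in> carrier_mat n n \<and> transpose_mat (a k) = a k \<and>
     x k \<in> carrier_mat n n \<and> transpose_mat (x k) = x k}"

fun ax_value :: "('g \<Rightarrow> real mat) \<Rightarrow> ('g \<Rightarrow> real mat) \<Rightarrow> 'g ax \<Rightarrow> real mat" where
  "ax_value a x (A_var k) = a k"
| "ax_value a x (X_var k) = x k"

definition word_eval :: "nat \<Rightarrow> ('v \<Rightarrow> real mat) \<Rightarrow> 'v list \<Rightarrow> real mat" where
  "word_eval n \<sigma> w = foldr (\<lambda>v M. \<sigma> v * M) w (1\<^sub>m n)"

definition nc_eval :: "nat \<Rightarrow> ('v \<Rightarrow> real mat) \<Rightarrow> ('v, real) ncpoly \<Rightarrow> real mat" where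
  "nc_eval n \<sigma> p = mat n n (\<lambda>(i, j).
     \<Sum>w\<in>Poly_Mapping.keys p. Poly_Mapping.lookup p w * word_eval n \<sigma> w $$ (i, j))"

text \<open>Entrywise evaluation gives a block matrix whose \<open>(i, j)\<close> block of size \<open>n \<times> n\<close> is the value of
  the entry \<open>M $$ (i, j)\<close>.\<close>

definition nc_mat_eval :: "nat \<Rightarrow> ('v \<Rightarrow> real mat) \<Rightarrow> ('v, real) ncpoly mat \<Rightarrow> real mat" where
  "nc_mat_eval n \<sigma> M = mat (dim_row M * n) (dim_col M * n) (\<lambda>(i, j).
     nc_eval n \<sigma> (M $$ (i div n, j div n)) $$ (i mod n, j mod n))"

end

theory Submission
  imports Defs
begin

text \<open>The Hessian of \<open>p\<close> arises from \<open>p\<close> by replacing two letters \<open>x\<close> in each word by \<open>h\<close>. Index the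
  rows and columns of \<open>Z\<close> by the border words, with the leading \<open>h\<close> turned back into \<open>x\<close>. Then
  the coefficient of a word \<open>z\<close> in the entry \<open>Z(d, e)\<close> is twice the coefficient of \<open>d\<^sup>T z e\<close> in \<open>p\<close>
  (\<open>middle_matrix_eq\<close>). So \<open>Z\<close> is a noncommutative Hankel matrix: only the concatenation matters.

  A word \<open>z\<close> either contains no \<open>x\<close>, and is then a word of \<open>Z(a,0)\<close>, or factors uniquely as
  \<open>z = s y\<close> where \<open>s\<close> ends with the first \<open>x\<close> of \<open>z\<close>. In the second case
  \<open>d\<^sup>T z e = (s\<^sup>T d)\<^sup>T y e\<close>, so the letters of \<open>s\<close> can be moved from the entry to the row index. This
  is the identity \<open>Z = Z(a,0) + N Z\<close> (\<open>middle_mat_step\<close>), where \<open>N(d, s\<^sup>T d) = s\<close> and all other entries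
  of \<open>N\<close> are zero. Since \<open>p\<close> is symmetric, so are \<open>Z\<close> and \<open>Z(a,0)\<close>, and with \<open>M = N\<^sup>T\<close> one gets
  \<open>Z (1 - M) = Z(a,0)\<close> and \<open>M\<^sup>T Z = Z M\<close>. Moreover \<open>M\<close> is nilpotent, as it raises the number of \<open>x\<close> in
  the index by one (\<open>step_mat_nilpotent\<close>).

  Hence \<open>A = 1 - M\<close> works, and the binomial series of \<open>sqrt (1 - t)\<close>, which is finite at the nilpotent
  \<open>M\<close>, gives a square root \<open>B\<close> of \<open>A\<close> that is a real polynomial in \<open>M\<close>. From \<open>M\<^sup>T Z = Z M\<close> follows
  \<open>B\<^sup>T Z = Z B\<close>, thus \<open>B\<^sup>T Z B = Z B\<^sup>2 = Z A = Z(a,0)\<close> (\<open>mat_sqrt\<close>). The inverse of \<open>B\<close> is a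
  polynomial in \<open>M\<close> as well, and evaluation, being multiplicative, preserves
  invertibility (\<open>invertible_nc_mat_eval\<close>).\<close>

section \<open>Coefficients of products and the involution\<close>

lemma ncpoly_induct [case_names zero add single]:
  fixes p :: "'k \<Rightarrow>\<^sub>0 'r::comm_monoid_add"
  assumes "P 0" and "\<And>p q. P p \<Longrightarrow> P q \<Longrightarrow> P (p + q)" and "\<And>w c. P (Poly_Mapping.single w c)"
  shows "P p"
proof -
  have eq: "p = (\<Sum>w\<in>Poly_Mapping.keys p. Poly_Mapping.single w (Poly_Mapping.lookup p w))"
    by (rule poly_mapping_eqI)
      (auto simp: lookup_sum lookup_single when_def in_keys_iff sum.delta' cong: if_cong)
  have "P (\<Sum>w\<in>S. Poly_Mapping.single w (Poly_Mapping.lookup p w))" if "finite S" for S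
    using that by (induction) (use assms in auto)
  then show ?thesis
    using eq finite_keys by metis
qed

text \<open>A word \<open>W\<close> has at most one factorization with left factor \<open>u\<close>, so multiplication by a single word
  shifts coefficients.\<close>

lemma lookup_single_mult:
  fixes q :: "('v, 'r::semiring_0) ncpoly"
  shows "Poly_Mapping.lookup (Poly_Mapping.single u c * q) (u @ w) = c * Poly_Mapping.lookup q w"
    and "(\<And>w. W \<noteq> u @ w) \<Longrightarrow> Poly_Mapping.lookup (Poly_Mapping.single u c * q) W = 0"
  by (induction q rule: ncpoly_induct)
    (auto simp: distrib_left lookup_add mult_single lookup_single when_def plus_list_def)

lemma lookup_mult_single:
  fixes q :: "('v, 'r::semiring_0) ncpoly"
  shows "Poly_Mapping.lookup (q * Poly_Mapping.single u c) (w @ u) = Poly_Mapping.lookup q w * c"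
    and "(\<And>w. W \<noteq> w @ u) \<Longrightarrow> Poly_Mapping.lookup (q * Poly_Mapping.single u c) W = 0"
  by (induction q rule: ncpoly_induct)
    (auto simp: distrib_right lookup_add mult_single lookup_single when_def plus_list_def)

lemma lookup_nc_monom_mult:
  fixes q :: "('v, 'r::semiring_1) ncpoly"
  shows "Poly_Mapping.lookup (nc_monom u * q) (u @ w) = Poly_Mapping.lookup q w"
    and "(\<And>w. W \<noteq> u @ w) \<Longrightarrow> Poly_Mapping.lookup (nc_monom u * q) W = 0"
  by (simp_all add: nc_monom_def lookup_single_mult)

lemma lookup_mult_nc_monom:
  fixes q :: "('v, 'r::semiring_1) ncpoly"
  shows "Poly_Mapping.lookup (q * nc_monom u) (w @ u) = Poly_Mapping.lookup q w"
    and "(\<And>w. W \<noteq> w @ u) \<Longrightarrow> Poly_Mapping.lookup (q * nc_monom u) W = 0"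
  by (simp_all add: nc_monom_def lookup_mult_single)

lemma lookup_nc_const_mult:
  fixes q :: "('v, 'r::semiring_0) ncpoly"
  shows "Poly_Mapping.lookup (nc_const c * q) w = c * Poly_Mapping.lookup q w"
  using lookup_single_mult(1)[of "[]" c q w] by (simp add: nc_const_def)

text \<open>Scalars commute with all polynomials; this is what lets one-variable polynomials be evaluated at a
  matrix over the free algebra below.\<close>

lemma nc_const_central:
  fixes q :: "('v, 'r::comm_semiring_0) ncpoly"
  shows "nc_const c * q = q * nc_const c"
proof (rule poly_mapping_eqI)
  show "Poly_Mapping.lookup (nc_const c * q) w = Poly_Mapping.lookup (q * nc_const c) w" for w
    using lookup_mult_single(1)[of q "[]" c w]
    by (simp add: lookup_nc_const_mult) (simp add: nc_const_def mult.commute)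
qed

lemma lookup_nc_star: "Poly_Mapping.lookup (nc_star p) w = Poly_Mapping.lookup p (rev w)"
  by (simp add: nc_star_def map_key.rep_eq)

lemma nc_star_simps:
  "nc_star 0 = 0"
  "nc_star (p + q) = nc_star p + nc_star (q :: ('v, 's::comm_monoid_add) ncpoly)"
  "nc_star (nc_star u) = u"
  "nc_star (Poly_Mapping.single w c) = Poly_Mapping.single (rev w) c"
  "nc_star (nc_const c) = nc_const c"
  "nc_star 1 = (1 :: ('v, 't::zero_neq_one) ncpoly)"
  by (rule poly_mapping_eqI;
      auto simp: lookup_nc_star lookup_add lookup_single when_def nc_const_def lookup_one zero_list_def)+

lemma nc_star_mult:
  fixes p q :: "('v, 'r::comm_semiring_0) ncpoly"
  shows "nc_star (p * q) = nc_star q * nc_star p"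
proof (induction p rule: ncpoly_induct)
  case (single w c)
  show ?case
    by (induction q rule: ncpoly_induct)
      (simp_all add: nc_star_simps distrib_left distrib_right mult_single plus_list_def mult.commute)
qed (simp_all add: nc_star_simps distrib_left distrib_right)

lemma nc_star_sum: "nc_star (sum f S) = (\<Sum>i\<in>S. nc_star (f i :: ('v, 's::comm_monoid_add) ncpoly))"
  by (induction S rule: infinite_finite_induct) (auto simp: nc_star_simps)

lemma mat_star_mult:
  fixes P Q :: "('v, 'r::comm_semiring_0) ncpoly mat"
  assumes "P \<in> carrier_mat n m" "Q \<in> carrier_mat m l"
  shows "mat_star (P * Q) = mat_star Q * mat_star P"
  by (rule eq_matI)
    (use assms in \<open>auto simp: mat_star_def scalar_prod_def nc_star_sum nc_star_mult intro!: sum.cong\<close>)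

section \<open>Substitution and the coefficients of the partial Hessian\<close>

lemma nc_subst_add:
  assumes "\<phi> 0 = 0" "\<And>a b. \<phi> (a + b) = \<phi> a + \<phi> b"
  shows "nc_subst \<phi> \<sigma> (p + q) = nc_subst \<phi> \<sigma> p + nc_subst \<phi> \<sigma> (q :: ('v, 'r::comm_monoid_add) ncpoly)"
  unfolding nc_subst_def
  by (rule setsum_keys_plus_distrib) (auto simp: assms distrib_right)

lemma nc_subst_single:
  assumes "\<phi> 0 = 0"
  shows "nc_subst \<phi> \<sigma> (Poly_Mapping.single w c) = \<phi> c * prod_list (map \<sigma> w)"
  by (simp add: nc_subst_def assms)

lemma nc_subst_zero: "nc_subst \<phi> \<sigma> 0 = 0"
  by (simp add: nc_subst_def)

lemma nc_const_simps: "nc_const 0 = 0" "nc_const (a + b) = nc_const a + nc_const b"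
  by (simp_all add: nc_const_def single_add)

lemma nc_monom_Nil: "nc_monom [] = (1 :: ('v, 'r::semiring_1) ncpoly)"
  by (simp add: nc_monom_def flip: zero_list_def)

lemma nc_monom_Cons: "nc_monom (v # w) = (nc_var v * nc_monom w :: ('v, 'r::semiring_1) ncpoly)"
  by (simp add: nc_var_def nc_monom_def mult_single plus_list_def)

lemma prod_list_nc_var:
  "prod_list (map (\<lambda>v. nc_var (f v)) w) = (nc_monom (map f w) :: ('v, 'r::semiring_1) ncpoly)"
  by (induction w) (simp_all add: nc_monom_Nil nc_monom_Cons)

lemma lookup_embed_ax:
  "Poly_Mapping.lookup (embed_ax q) (map AX_var z) = Poly_Mapping.lookup q z"
  "(\<And>z. W \<noteq> map AX_var z) \<Longrightarrow> Poly_Mapping.lookup (embed_ax q) W = 0"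
proof -
  have inj: "map AX_var z = map AX_var z' \<longleftrightarrow> z = z'" for z z' :: "'a ax list"
    by (simp add: inj_map_eq_map inj_def)
  show "Poly_Mapping.lookup (embed_ax q) (map AX_var z) = Poly_Mapping.lookup q z"
  by (induction q rule: ncpoly_induct)
    (auto simp: embed_ax_def nc_subst_zero nc_subst_add nc_subst_single nc_const_simps lookup_add
      lookup_nc_const_mult prod_list_nc_var nc_monom_def lookup_single when_def inj)
  show "(\<And>z. W \<noteq> map AX_var z) \<Longrightarrow> Poly_Mapping.lookup (embed_ax q) W = 0"
  by (induction q rule: ncpoly_induct)
    (auto simp: embed_ax_def nc_subst_zero nc_subst_add nc_subst_single nc_const_simps lookup_add
      lookup_nc_const_mult prod_list_nc_var nc_monom_def lookup_single when_def inj)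
qed

lemma lookup_x_zero:
  "Poly_Mapping.lookup (x_zero q) z = (if \<exists>v\<in>set z. is_x v then 0 else Poly_Mapping.lookup q z)"
proof -
  have *: "prod_list (map (\<lambda>v. if is_x v then 0 else nc_var v) w) =
    (if \<exists>v\<in>set w. is_x v then 0 else nc_monom w :: ('a ax, real) ncpoly)" for w
    by (induction w) (simp_all add: nc_monom_Nil nc_monom_Cons)
  show ?thesis
    by (induction q rule: ncpoly_induct)
      (auto simp: x_zero_def nc_subst_zero nc_subst_add nc_subst_single nc_const_simps lookup_add
      lookup_nc_const_mult * nc_monom_def lookup_single when_def)
qed

fun erase :: "'g axh \<Rightarrow> 'g ax" where
  "erase (AX_var v) = v"
| "erase (H_var k) = X_var k"

fun is_h :: "'g axh \<Rightarrow> bool" where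
  "is_h (AX_var v) = False"
| "is_h (H_var k) = True"

lemma lookup_nc_var_mult:
  fixes q :: "('v, 'r::semiring_1) ncpoly"
  shows "Poly_Mapping.lookup (nc_var y * q) [] = 0"
    "Poly_Mapping.lookup (nc_var y * q) (v # W) = (if v = y then Poly_Mapping.lookup q W else 0)"
  using lookup_nc_monom_mult(1)[of "[y]" q W] lookup_nc_monom_mult(2)[of _ "[y]" q]
  by (auto simp: nc_var_def)

text \<open>Expanding the product of the factors \<open>x\<^sub>k + t h\<^sub>k\<close> amounts to choosing, at each position of an
  \<open>x\<close>, whether to replace it by \<open>h\<close>. A word \<open>W\<close> records its own choice: it arises from the single
  word \<open>map erase W\<close>, with one factor \<open>t\<close> for each \<open>h\<close>.\<close>

lemma lookup_shift_word:
  "Poly_Mapping.lookup (prod_list (map shift_var w)) W =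
     (if map erase W = w then monom 1 (length (filter is_h W)) else 0)"
proof (induction w arbitrary: W)
  case Nil
  then show ?case by (auto simp: lookup_one zero_list_def when_def)
next
  case (Cons v w)
  have "Poly_Mapping.lookup (shift_var v * q) W = (case W of [] \<Rightarrow> 0
     | y # W' \<Rightarrow> if erase y = v then monom 1 (if is_h y then 1 else 0) * Poly_Mapping.lookup q W' else 0)" for q W
    by (cases v; cases W; cases "hd W")
      (auto simp: lookup_nc_var_mult distrib_right lookup_add mult.assoc lookup_nc_const_mult monom_altdef)
  with Cons show ?case
    by (auto simp: mult_monom split: list.splits)
qed

lemma lookup_x_shift:
  "Poly_Mapping.lookup (x_shift p) W = monom (Poly_Mapping.lookup p (map erase W)) (length (filter is_h W))"
proof -
  have "nc_const [:a + b:] = (nc_const [:a:] + nc_const [:b:] :: ('a axh, real poly) ncpoly)" for a b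
    by (simp flip: nc_const_simps)
  then show ?thesis
    by (induction p rule: ncpoly_induct)
      (auto simp: x_shift_def nc_subst_zero nc_subst_add nc_subst_single nc_const_simps(1) lookup_add
        lookup_nc_const_mult lookup_shift_word lookup_single when_def smult_monom add_monom)
qed

text \<open>The second derivative at \<open>t = 0\<close> keeps the multiples of \<open>t\<^sup>2\<close>, doubled: the words with exactly two
  \<open>h\<close>.\<close>

lemma lookup_partial_hessian:
  "Poly_Mapping.lookup (partial_hessian p) W =
     (if length (filter is_h W) = 2 then 2 * Poly_Mapping.lookup p (map erase W) else 0)"
  by (auto simp: partial_hessian_def map.rep_eq lookup_x_shift pderiv_monom poly_monom when_def)

section \<open>The entries of the middle matrix\<close>

abbreviation xdeg :: "'g ax list \<Rightarrow> nat" where "xdeg u \<equiv> length (filter is_x u)"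
abbreviation adeg :: "'g ax list \<Rightarrow> nat" where "adeg u \<equiv> length (filter is_a u)"

text \<open>Cutting a word in \<open>a, x\<close> at its letters \<open>x\<close> shows that border words are just the words with leading
  \<open>h\<close> subject to bounds on the two degrees.\<close>

lemma border_words_eq:
  "border_words da j = {H_var (k :: 'g) # map AX_var u | k u. xdeg u = j \<and> adeg u \<le> da}"
proof -
  let ?e = "\<lambda>m0 kms. map A_var m0 @ concat (map (\<lambda>(i, m). X_var i # map A_var m) kms)"
  have x: "xdeg (?e m0 kms) = length kms" and a: "adeg (?e m0 kms) = length m0 + (\<Sum>(i, m)\<leftarrow>kms. length m)"
    for m0 :: "'g list" and kms
    by (induction kms) (auto simp: filter_map o_def)
  have ex: "\<exists>m0 kms. u = ?e m0 kms" for u :: "'g ax list"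
  proof (induction u)
    case Nil
    show ?case by (rule exI[of _ "[]"], rule exI[of _ "[]"]) simp
  next
    case (Cons v u)
    then obtain m0 kms where u: "u = ?e m0 kms" by blast
    show ?case
    proof (cases v)
      case (A_var k)
      then show ?thesis using u by (intro exI[of _ "k # m0"] exI[of _ kms]) simp
    next
      case (X_var k)
      then show ?thesis using u by (intro exI[of _ "[]"] exI[of _ "(k, m0) # kms"]) simp
    qed
  qed
  show ?thesis
  proof (intro equalityI subsetI)
    fix w :: "'g axh list" assume "w \<in> border_words da j"
    then show "w \<in> {H_var k # map AX_var u | k u. xdeg u = j \<and> adeg u \<le> da}"
    proof -
      obtain k m0 kms where *: "w = H_var k # map AX_var (?e m0 kms)" "length kms = j"
          "length m0 + (\<Sum>(i, m)\<leftarrow>kms. length m) \<le> da"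
        using \<open>w \<in> border_words da j\<close> unfolding border_words_def border_word_def by blast
      then have "xdeg (?e m0 kms) = j \<and> adeg (?e m0 kms) \<le> da"
        unfolding x a by blast
      then show ?thesis using *(1) by blast
    qed
  next
    fix w :: "'g axh list" assume "w \<in> {H_var k # map AX_var u | k u. xdeg u = j \<and> adeg u \<le> da}"
    then obtain k u where w: "w = H_var k # map AX_var u" "xdeg u = j" "adeg u \<le> da" by blast
    moreover obtain m0 kms where u: "u = ?e m0 kms" using ex by blast
    ultimately have "length kms = j" "length m0 + (\<Sum>(i, m)\<leftarrow>kms. length m) \<le> da"
      unfolding u x a by blast+
    then show "w \<in> border_words da j"
      unfolding border_words_def border_word_def using w(1) u by blast
  qed
qed

lemma border_list:
  assumes "is_border da dx (ws :: 'g axh list list)"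
  shows "distinct ws"
    and "set ws = {H_var k # map AX_var u | k u. xdeg u + 2 \<le> dx \<and> adeg u \<le> da}"
proof -
  obtain Vs where len: "length Vs = dx - 1" and ws: "ws = concat Vs"
    and Vs: "\<And>j. j < dx - 1 \<Longrightarrow> distinct (Vs ! j)" "\<And>j. j < dx - 1 \<Longrightarrow> set (Vs ! j) = border_words da j"
    using assms unfolding is_border_def by blast
  have inj: "map AX_var u = map AX_var u' \<longleftrightarrow> u = u'" for u u' :: "'g ax list"
    by (simp add: inj_map_eq_map inj_def)
  have disj: "border_words da i \<inter> border_words da j = ({} :: 'g axh list set)" if "i \<noteq> j" for i j
    using that by (auto simp: border_words_eq inj)
  have ne: "border_words da j \<noteq> ({} :: 'g axh list set)" for j
  proof -
    have "H_var undefined # map AX_var (replicate j (X_var undefined)) \<in> (border_words da j :: 'g axh list set)"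
      unfolding border_words_eq
      by (intro CollectI exI[of _ undefined] exI[of _ "replicate j (X_var undefined)"]) simp
    then show ?thesis by blast
  qed
  show "distinct ws"
    unfolding ws
  proof (rule distinct_concat)
    show "distinct Vs"
      unfolding distinct_conv_nth using Vs(2) len disj ne by (metis inf.idem)
    show "distinct ys" if "ys \<in> set Vs" for ys
      using that Vs(1) len by (metis in_set_conv_nth)
    show "set ys \<inter> set zs = {}" if "ys \<in> set Vs" "zs \<in> set Vs" "ys \<noteq> zs" for ys zs
      using that Vs(2) len disj by (metis in_set_conv_nth)
  qed
  have "set ws = (\<Union>j<dx - 1. border_words da j)"
  proof -
    have "set Vs = (!) Vs ` {..<dx - 1}" using len by (auto simp: set_conv_nth)
    then show ?thesis by (simp add: ws set_concat Vs(2))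
  qed
  also have "\<dots> = {H_var k # map AX_var u | k u. xdeg u + 2 \<le> dx \<and> adeg u \<le> da}"
    by (auto simp: border_words_eq inj)
  finally show "set ws = {H_var k # map AX_var u | k u. xdeg u + 2 \<le> dx \<and> adeg u \<le> da}" .
qed

lemma length_filter_le_nc_degree:
  assumes "w \<in> Poly_Mapping.keys p"
  shows "length (filter P w) \<le> nc_degree P p"
  unfolding nc_degree_def by (rule Max_ge) (use assms in auto)

text \<open>The entry of the middle matrix in row \<open>d\<close> and column \<open>e\<close>, where \<open>d\<close> and \<open>e\<close> are border words with
  their leading \<open>h\<close> turned into \<open>x\<close>. By the description of the Hessian, the coefficient of \<open>d\<^sup>T z e\<close>
  in \<open>p\<close> is, up to the factor 2, the coefficient of \<open>z\<close> in this entry.\<close>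

definition middle_entry :: "('g ax, real) ncpoly \<Rightarrow> 'g ax list \<Rightarrow> 'g ax list \<Rightarrow> ('g ax, real) ncpoly" where
  "middle_entry p d e = Poly_Mapping.map ((*) 2) (Poly_Mapping.map_key (\<lambda>z. rev d @ z @ e) p)"

lemma lookup_middle_entry:
  "Poly_Mapping.lookup (middle_entry p d e) z = 2 * Poly_Mapping.lookup p (rev d @ z @ e)"
  by (simp add: middle_entry_def map.rep_eq map_key.rep_eq inj_def when_def)

lemma first_h_unique:
  assumes "map AX_var u @ H_var k # r = map AX_var u' @ H_var k' # r'"
  shows "u = u' \<and> k = k' \<and> r = r'"
  using assms
proof (induction u arbitrary: u')
  case Nil
  then show ?case by (cases u') auto
next
  case (Cons v u)
  then show ?case by (cases u') auto
qed

lemma first_h_exists: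
  assumes "filter is_h W \<noteq> []"
  shows "\<exists>u k r. W = map AX_var u @ H_var k # r"
  using assms
proof (induction W)
  case (Cons y W)
  show ?case
  proof (cases y)
    case (H_var k)
    then show ?thesis by (metis append_Nil list.map(1))
  next
    case (AX_var v)
    then obtain u k r where "W = map AX_var u @ H_var k # r" using Cons by auto
    then show ?thesis using AX_var by (metis append_Cons list.map(2))
  qed
qed simp

lemma no_h_exists:
  assumes "filter is_h W = []"
  shows "\<exists>z. W = map AX_var z"
  using assms
proof (induction W)
  case (Cons y W)
  then show ?case by (cases y) (auto simp: Cons_eq_map_conv)
qed simp

lemma filter_is_h_AX: "filter is_h (map AX_var u) = []"
  by (induction u) auto

lemma two_h_decompose:
  assumes "length (filter is_h W) = 2"
  shows "\<exists>k u z l v. W = rev (H_var k # map AX_var u) @ map AX_var z @ H_var l # map AX_var v"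
proof -
  obtain u k r where W: "W = map AX_var u @ H_var k # r"
    using first_h_exists[of W] assms by fastforce
  with assms have "length (filter is_h r) = 1" by (simp add: filter_is_h_AX)
  then obtain z l s where r: "r = map AX_var z @ H_var l # s"
    using first_h_exists[of r] by fastforce
  with \<open>length (filter is_h r) = 1\<close> have "filter is_h s = []" by (simp add: filter_is_h_AX)
  then obtain v where "s = map AX_var v" using no_h_exists by blast
  then have "W = rev (H_var k # map AX_var (rev u)) @ map AX_var z @ H_var l # map AX_var v"
    using W r by (simp add: rev_map)
  then show ?thesis by blast
qed

text \<open>The two letters \<open>h\<close> mark where a Hessian word has to be cut into (transposed border word, word in
  \<open>a, x\<close>, border word). This unique factorization makes the middle matrix unique.\<close>

lemma two_h_unique:
  assumes "rev (H_var k # map AX_var u) @ map AX_var z @ H_var l # map AX_var v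
    = rev (H_var k' # map AX_var u') @ map AX_var z' @ H_var l' # map AX_var v'"
  shows "k = k' \<and> u = u' \<and> z = z' \<and> l = l' \<and> v = v'"
proof -
  have "map AX_var (rev u) @ H_var k # map AX_var z @ H_var l # map AX_var v
     = map AX_var (rev u') @ H_var k' # map AX_var z' @ H_var l' # map AX_var v'"
    using assms by (simp add: rev_map)
  from first_h_unique[OF this] have 1: "u = u'" "k = k'"
    "map AX_var z @ H_var l # map AX_var v = map AX_var z' @ H_var l' # map AX_var v'" by auto
  have "map AX_var v = map AX_var v' \<longleftrightarrow> v = v'"
    by (simp add: inj_map_eq_map inj_def)
  with 1 first_h_unique[OF 1(3)] show ?thesis by auto
qed

text \<open>By unique factorization each coefficient of \<open>V\<^sup>T Z V\<close> is a single coefficient of a single entry of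
  \<open>Z\<close>, so comparing coefficients with the Hessian forces the entries of \<open>Z\<close>. For the solution thus
  found to be one, no Hessian word may be missed: the outer factors of a word with two \<open>h\<close> that occurs
  in the Hessian have to be border words, which the bounds on the degrees of \<open>p\<close> ensure.\<close>

lemma middle_matrix_eq:
  fixes p :: "('g ax, real) ncpoly"
  assumes border: "is_border (nc_degree is_a p) (nc_degree is_x p) ws"
  shows "middle_matrix ws p = mat (length ws) (length ws)
    (\<lambda>(i, j). middle_entry p (map erase (ws ! i)) (map erase (ws ! j)))" (is "_ = ?Z")
proof -
  let ?n = "length ws"
  let ?L = "Poly_Mapping.lookup"
  let ?W = "\<lambda>i z j. rev (ws ! i) @ map AX_var z @ ws ! j"
  let ?R = "\<lambda>Z. mat_star (border_vector ws) * map_mat embed_ax Z * border_vector ws"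
  note ws = border_list[OF border]
  have form: "\<exists>k u. ws ! i = H_var k # map AX_var u" if "i < ?n" for i
    using nth_mem[OF that] ws(2) by blast
  have unique: "i = i' \<and> z = z' \<and> j = j'"
    if W: "?W i z j = ?W i' z' j'" and ij: "i < ?n" "j < ?n" "i' < ?n" "j' < ?n" for i j i' j' z z'
  proof -
    obtain k u where i: "ws ! i = H_var k # map AX_var u" using form[OF ij(1)] by blast
    obtain l v where j: "ws ! j = H_var l # map AX_var v" using form[OF ij(2)] by blast
    obtain k' u' where i': "ws ! i' = H_var k' # map AX_var u'" using form[OF ij(3)] by blast
    obtain l' v' where j': "ws ! j' = H_var l' # map AX_var v'" using form[OF ij(4)] by blast
    have "k = k' \<and> u = u' \<and> z = z' \<and> l = l' \<and> v = v'"
      by (rule two_h_unique) (use W in \<open>simp only: i j i' j'\<close>)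
    then have "ws ! i = ws ! i'" "z = z'" "ws ! j = ws ! j'" by (simp_all only: i j i' j')
    then show ?thesis using ws(1) ij by (simp add: nth_eq_iff_index_eq)
  qed
  have R: "?R Z $$ (0, 0) = (\<Sum>j<?n. \<Sum>i<?n. nc_monom (rev (ws ! i)) * embed_ax (Z $$ (i, j)) * nc_monom (ws ! j))"
    if "Z \<in> carrier_mat ?n ?n" for Z
    using that
    by (simp add: mat_star_def border_vector_def scalar_prod_def nc_monom_def nc_star_simps
        sum_distrib_right lessThan_atLeast0)
  have term_lookup: "?L (nc_monom (rev (ws ! i)) * embed_ax q * nc_monom (ws ! j)) W
     = (if \<exists>z. W = ?W i z j then ?L q (THE z. W = ?W i z j) else 0)" for i j q W
  proof -
    have AX: "map AX_var z = map AX_var z' \<longleftrightarrow> z = z'" for z z' :: "'g ax list"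
      by (simp add: inj_map_eq_map inj_def)
    show ?thesis
    proof (cases "\<exists>z. W = ?W i z j")
      case True
      then obtain z where z: "W = ?W i z j" by blast
      have "?L (nc_monom (rev (ws ! i)) * embed_ax q * nc_monom (ws ! j)) W = ?L q z"
        by (simp add: z mult.assoc lookup_nc_monom_mult lookup_mult_nc_monom lookup_embed_ax)
      moreover have "(THE z. W = ?W i z j) = z"
        by (rule the_equality) (use AX in \<open>simp_all add: z\<close>)
      ultimately show ?thesis using True by simp
    next
      case False
      have "?L (nc_monom (rev (ws ! i)) * (embed_ax q * nc_monom (ws ! j))) W = 0"
      proof (cases "\<exists>y. W = rev (ws ! i) @ y")
        case True
        then obtain y where y: "W = rev (ws ! i) @ y" by blast
        have "?L (embed_ax q * nc_monom (ws ! j)) y = 0"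
        proof (cases "\<exists>x. y = x @ ws ! j")
          case True
          then obtain x where "y = x @ ws ! j" by blast
          moreover have "?L (embed_ax q) x = 0"
            using False y \<open>y = x @ ws ! j\<close> by (intro lookup_embed_ax(2)) auto
          ultimately show ?thesis by (simp add: lookup_mult_nc_monom)
        qed (simp add: lookup_mult_nc_monom)
        then show ?thesis using y by (simp add: lookup_nc_monom_mult)
      qed (simp add: lookup_nc_monom_mult)
      then show ?thesis using False by (simp add: mult.assoc)
    qed
  qed
  have lookup_R: "?L (?R Z $$ (0, 0)) (?W i z j) = ?L (Z $$ (i, j)) z"
    if Z: "Z \<in> carrier_mat ?n ?n" and ij: "i < ?n" "j < ?n" for Z i j z
  proof -
    have "?L (nc_monom (rev (ws ! i')) * embed_ax (Z $$ (i', j')) * nc_monom (ws ! j')) (?W i z j)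
      = (if i' = i then if j' = j then ?L (Z $$ (i, j)) z else 0 else 0)"
      if ij': "i' < ?n" "j' < ?n" for i' j'
    proof (cases "i' = i \<and> j' = j")
      case True
      have "(THE z'. ?W i z j = ?W i z' j) = z"
        by (rule the_equality) (use unique[OF _ ij ij] in blast)+
      moreover have "\<exists>z'. ?W i z j = ?W i z' j" by blast
      ultimately show ?thesis using True unfolding term_lookup by simp
    next
      case False
      then have "\<not> (\<exists>z'. ?W i z j = ?W i' z' j')"
        using unique[OF _ ij ij'] by blast
      then show ?thesis using False unfolding term_lookup by auto
    qed
    then show ?thesis
      unfolding R[OF Z] using ij by (simp add: lookup_sum sum.delta cong: if_cong)
  qed
  have lookup_R0: "?L (?R Z $$ (0, 0)) W = 0"
    if Z: "Z \<in> carrier_mat ?n ?n" and W: "\<And>i j z. i < ?n \<Longrightarrow> j < ?n \<Longrightarrow> W \<noteq> ?W i z j" for Z W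
    unfolding R[OF Z] lookup_sum term_lookup using W by (intro sum.neutral ballI) auto
  have erase_AX: "map erase (map AX_var z) = z" for z :: "'g ax list"
    by (induction z) auto
  have lookup_hess: "?L (partial_hessian p) (?W i z j) = ?L (?Z $$ (i, j)) z"
    if ij: "i < ?n" "j < ?n" for i j z
  proof -
    obtain k u l v where "ws ! i = H_var k # map AX_var u" "ws ! j = H_var l # map AX_var v"
      using form[OF ij(1)] form[OF ij(2)] by blast
    then have "length (filter is_h (?W i z j)) = 2" by (simp add: filter_is_h_AX flip: rev_map)
    moreover have "map erase (?W i z j) = rev (map erase (ws ! i)) @ z @ map erase (ws ! j)"
      by (simp only: map_append rev_map erase_AX)
    ultimately show ?thesis
      using ij by (simp add: lookup_partial_hessian lookup_middle_entry)
  qed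
  \<comment> \<open>The two \<open>h\<close> stand for letters \<open>x\<close> of a word of \<open>p\<close>, which leaves at most \<open>d\<^sub>x - 2\<close> letters \<open>x\<close> for
    each outer factor.\<close>
  have lookup_hess0: "?L (partial_hessian p) W = 0"
    if W: "\<And>i j z. i < ?n \<Longrightarrow> j < ?n \<Longrightarrow> W \<noteq> ?W i z j" for W
  proof (rule ccontr)
    assume nz: "?L (partial_hessian p) W \<noteq> 0"
    then have 2: "length (filter is_h W) = 2" and key: "map erase W \<in> Poly_Mapping.keys p"
      by (auto simp: lookup_partial_hessian in_keys_iff split: if_splits)
    obtain k u z l v where Weq: "W = rev (H_var k # map AX_var u) @ map AX_var z @ H_var l # map AX_var v"
      using two_h_decompose[OF 2] by blast
    let ?w = "rev u @ X_var k # z @ X_var l # v"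
    have "map erase W = ?w"
      by (simp only: Weq map_append rev_map list.map erase_AX rev.simps erase.simps append_assoc append_Cons append_Nil)
    then have "adeg ?w \<le> nc_degree is_a p" "xdeg ?w \<le> nc_degree is_x p"
      using key by (simp_all only: length_filter_le_nc_degree)
    then have "H_var k # map AX_var u \<in> set ws" "H_var l # map AX_var v \<in> set ws"
      unfolding ws(2) by (auto simp flip: rev_filter)
    then show False using W Weq by (metis in_set_conv_nth)
  qed
  have iff: "mat 1 1 (\<lambda>_. partial_hessian p) = ?R Z \<longleftrightarrow> Z = ?Z"
    if Z: "Z \<in> carrier_mat ?n ?n" for Z
  proof -
    have "mat 1 1 (\<lambda>_. partial_hessian p) = ?R Z \<longleftrightarrow> partial_hessian p = ?R Z $$ (0, 0)"
      by (auto simp: mat_eq_iff mat_star_def border_vector_def)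
    also have "\<dots> \<longleftrightarrow> (\<forall>i<?n. \<forall>j<?n. \<forall>z. ?L (Z $$ (i, j)) z = ?L (?Z $$ (i, j)) z)"
    proof (intro iffI allI impI)
      fix i j z assume "partial_hessian p = ?R Z $$ (0, 0)" "i < ?n" "j < ?n"
      then show "?L (Z $$ (i, j)) z = ?L (?Z $$ (i, j)) z"
        using lookup_R[OF Z] lookup_hess by metis
    next
      assume *: "\<forall>i<?n. \<forall>j<?n. \<forall>z. ?L (Z $$ (i, j)) z = ?L (?Z $$ (i, j)) z"
      show "partial_hessian p = ?R Z $$ (0, 0)"
      proof (rule poly_mapping_eqI)
        fix W
        show "?L (partial_hessian p) W = ?L (?R Z $$ (0, 0)) W"
        proof (cases "\<exists>i j z. i < ?n \<and> j < ?n \<and> W = ?W i z j")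
          case True
          then obtain i j z where "i < ?n" "j < ?n" and W: "W = ?W i z j" by blast
          then show ?thesis unfolding W using lookup_R[OF Z] lookup_hess * by simp
        next
          case False
          then have "\<And>i j z. i < ?n \<Longrightarrow> j < ?n \<Longrightarrow> W \<noteq> ?W i z j" by blast
          then show ?thesis by (simp add: lookup_R0[OF Z] lookup_hess0)
        qed
      qed
    qed
    also have "\<dots> \<longleftrightarrow> Z = ?Z"
    proof
      assume *: "\<forall>i<?n. \<forall>j<?n. \<forall>z. ?L (Z $$ (i, j)) z = ?L (?Z $$ (i, j)) z"
      show "Z = ?Z"
      proof (rule eq_matI)
        fix i j assume "i < dim_row ?Z" "j < dim_col ?Z"
        then show "Z $$ (i, j) = ?Z $$ (i, j)"
          using * by (intro poly_mapping_eqI) simp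
      qed (use Z in auto)
    qed simp
    finally show ?thesis .
  qed
  show ?thesis
    unfolding middle_matrix_def
  proof (rule the_equality)
    have "?Z \<in> carrier_mat ?n ?n" by simp
    then show "?Z \<in> carrier_mat ?n ?n \<and> mat 1 1 (\<lambda>_. partial_hessian p) = ?R ?Z"
      using iff by blast
  qed (use iff in blast)
qed

section \<open>Real polynomials of a matrix and the square root\<close>

lemma nc_const_mult: "nc_const (a * b) = (nc_const a * nc_const b :: ('v, 'r::semiring_0) ncpoly)"
  by (simp add: nc_const_def mult_single plus_list_def)

text \<open>The value \<open>q(M)\<close>, by Horner's scheme. All such values, for fixed \<open>M\<close>, commute, so identities between
  one-variable polynomials turn into identities between matrices over the free algebra.\<close>

definition mat_poly :: "nat \<Rightarrow> ('v, real) ncpoly mat \<Rightarrow> real poly \<Rightarrow> ('v, real) ncpoly mat" where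
  "mat_poly n M q = fold_coeffs (\<lambda>c S. nc_const c \<cdot>\<^sub>m 1\<^sub>m n + M * S) q (0\<^sub>m n n)"

lemma mult_const_smult:
  fixes P Q :: "('v, real) ncpoly mat"
  assumes "P \<in> carrier_mat n m" "Q \<in> carrier_mat m l"
  shows "P * (nc_const c \<cdot>\<^sub>m Q) = nc_const c \<cdot>\<^sub>m (P * Q)"
proof (rule eq_matI)
  fix i j assume "i < dim_row (nc_const c \<cdot>\<^sub>m (P * Q))" "j < dim_col (nc_const c \<cdot>\<^sub>m (P * Q))"
  moreover have "x * (nc_const c * y) = nc_const c * (x * y)" for x y :: "('v, real) ncpoly"
    by (metis mult.assoc nc_const_central)
  ultimately show "(P * (nc_const c \<cdot>\<^sub>m Q)) $$ (i, j) = (nc_const c \<cdot>\<^sub>m (P * Q)) $$ (i, j)"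
    using assms by (simp add: scalar_prod_def sum_distrib_left)
qed (use assms in auto)

lemma const_smult_mult:
  fixes P Q :: "('v, real) ncpoly mat"
  assumes "P \<in> carrier_mat n m" "Q \<in> carrier_mat m l"
  shows "(nc_const c \<cdot>\<^sub>m P) * Q = nc_const c \<cdot>\<^sub>m (P * Q)"
  by (rule eq_matI) (use assms in \<open>auto simp: scalar_prod_def sum_distrib_left mult.assoc\<close>)

context
  fixes n :: nat and M :: "('v, real) ncpoly mat"
  assumes M [simp]: "M \<in> carrier_mat n n"
begin

lemma dim_M [simp]: "dim_row M = n" "dim_col M = n"
  by (rule carrier_matD[OF M])+

lemma mat_poly_0 [simp]: "mat_poly n M 0 = 0\<^sub>m n n"
  by (simp add: mat_poly_def)

lemma mat_poly_pCons: "mat_poly n M (pCons c q) = nc_const c \<cdot>\<^sub>m 1\<^sub>m n + M * mat_poly n M q"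
proof (cases "pCons c q = 0")
  case True
  then have "c = 0" "q = 0" by auto
  then show ?thesis
    by (intro eq_matI) (auto simp: nc_const_simps)
qed (auto simp: mat_poly_def)

lemma mat_poly_carrier [simp]: "mat_poly n M q \<in> carrier_mat n n"
  by (induction q)
    (auto simp: mat_poly_pCons intro!: add_carrier_mat smult_carrier_mat mult_carrier_mat[OF M])

lemma dim_mat_poly [simp]: "dim_row (mat_poly n M q) = n" "dim_col (mat_poly n M q) = n"
  by (rule carrier_matD[OF mat_poly_carrier])+

lemma mat_poly_add: "mat_poly n M (p + q) = mat_poly n M p + mat_poly n M q"
proof (induction p q rule: poly_induct2)
  case (pCons a p b q)
  have "mat_poly n M (pCons a p + pCons b q)
    = nc_const (a + b) \<cdot>\<^sub>m 1\<^sub>m n + (M * mat_poly n M p + M * mat_poly n M q)"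
    by (simp add: mat_poly_pCons pCons mult_add_distrib_mat[OF M mat_poly_carrier mat_poly_carrier])
  also have "\<dots> = mat_poly n M (pCons a p) + mat_poly n M (pCons b q)"
    unfolding mat_poly_pCons
    by (rule eq_matI) (auto simp: nc_const_simps distrib_right simp del: index_mult_mat(1))
  finally show ?case .
qed simp

lemma mat_poly_smult: "mat_poly n M (Polynomial.smult c q) = nc_const c \<cdot>\<^sub>m mat_poly n M q"
proof (induction q)
  case (pCons a q)
  show ?case
    unfolding smult_pCons mat_poly_pCons pCons mult_const_smult[OF M mat_poly_carrier]
    by (rule eq_matI) (auto simp: nc_const_mult distrib_left mult.assoc simp del: index_mult_mat(1))
qed auto

lemma mat_poly_mult: "mat_poly n M (p * q) = mat_poly n M p * mat_poly n M q"
proof (induction p)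
  case (pCons a p)
  let ?P = "mat_poly n M p" and ?Q = "mat_poly n M q"
  have "mat_poly n M (pCons a p * q) = nc_const a \<cdot>\<^sub>m ?Q + (0\<^sub>m n n + M * (?P * ?Q))"
  proof -
    have "nc_const 0 \<cdot>\<^sub>m 1\<^sub>m n = (0\<^sub>m n n :: ('v, real) ncpoly mat)"
      by (rule eq_matI) (auto simp: nc_const_simps)
    then show ?thesis by (simp add: mat_poly_add mat_poly_smult mat_poly_pCons pCons)
  qed
  also have "\<dots> = (nc_const a \<cdot>\<^sub>m 1\<^sub>m n) * ?Q + M * ?P * ?Q"
  proof -
    have "M * (?P * ?Q) \<in> carrier_mat n n"
      by (intro mult_carrier_mat[of _ n n] M mat_poly_carrier)
    then show ?thesis
      using const_smult_mult[of "1\<^sub>m n" n n ?Q n a]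
      by (simp add: assoc_mult_mat[OF M mat_poly_carrier mat_poly_carrier])
  qed
  also have "\<dots> = mat_poly n M (pCons a p) * ?Q"
    unfolding mat_poly_pCons by (rule add_mult_distrib_mat[symmetric, where n = n and nc = n]) (use M in auto)
  finally show ?case .
qed simp

lemma mat_poly_1 [simp]: "mat_poly n M 1 = 1\<^sub>m n"
  unfolding one_pCons mat_poly_pCons by (rule eq_matI) (auto simp: nc_const_def simp flip: zero_list_def)

lemma mat_poly_X [simp]: "mat_poly n M [:0, 1:] = M"
proof -
  have "nc_const 0 \<cdot>\<^sub>m 1\<^sub>m n + M = M"
    by (rule eq_matI) (auto simp: nc_const_simps)
  then show ?thesis
    using M by (simp add: mat_poly_pCons[of 0] flip: one_pCons)
qed

lemma mat_poly_commute: "M * mat_poly n M q = mat_poly n M q * M"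
  using mat_poly_mult[of "[:0, 1:]" q] mat_poly_mult[of q "[:0, 1:]"] by (simp add: mult.commute del: mult_pCons_left mult_pCons_right)

text \<open>If \<open>M\<^sup>T Z = Z M\<close>, then \<open>Z\<close> intertwines every power of \<open>M\<close> with that of \<open>M\<^sup>T\<close>. The transpose of
  \<open>q(M)\<close> is \<open>q(M\<^sup>T)\<close> as the scalars are fixed by the involution.\<close>

lemma mat_star_mat_poly:
  assumes Z: "Z \<in> carrier_mat n n" and comm: "mat_star M * Z = Z * M"
  shows "mat_star (mat_poly n M q) * Z = Z * mat_poly n M q"
proof (induction q)
  case 0
  then show ?case using Z by (intro eq_matI) (auto simp: mat_star_def nc_star_simps scalar_prod_def)
next
  case (pCons c q)
  let ?Q = "mat_poly n M q"
  have star_carrier [simp]: "mat_star P \<in> carrier_mat n n" if "P \<in> carrier_mat n n" for P :: "('v, real) ncpoly mat"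
    using that by (simp add: mat_star_def)
  have "mat_star (nc_const c \<cdot>\<^sub>m 1\<^sub>m n + M * ?Q) = nc_const c \<cdot>\<^sub>m 1\<^sub>m n + mat_star (?Q * M)"
    by (rule eq_matI) (auto simp: mat_star_def nc_star_simps nc_star_mult mat_poly_commute simp del: index_mult_mat(1))
  also have "mat_star (?Q * M) = mat_star M * mat_star ?Q"
    by (rule mat_star_mult) (use M in auto)
  finally have "mat_star (mat_poly n M (pCons c q)) * Z = (nc_const c \<cdot>\<^sub>m 1\<^sub>m n + mat_star M * mat_star ?Q) * Z"
    by (simp add: mat_poly_pCons)
  also have "\<dots> = nc_const c \<cdot>\<^sub>m Z + mat_star M * (mat_star ?Q * Z)"
  proof -
    have "mat_star M * mat_star ?Q \<in> carrier_mat n n"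
      by (intro mult_carrier_mat[of _ n n] star_carrier M mat_poly_carrier)
    then have "(nc_const c \<cdot>\<^sub>m 1\<^sub>m n + mat_star M * mat_star ?Q) * Z
      = (nc_const c \<cdot>\<^sub>m 1\<^sub>m n) * Z + mat_star M * mat_star ?Q * Z"
      by (intro add_mult_distrib_mat[OF _ _ Z]) auto
    then show ?thesis
      using const_smult_mult[of "1\<^sub>m n" n n Z n c] Z
      by (simp add: assoc_mult_mat[OF star_carrier[OF M] star_carrier[OF mat_poly_carrier] Z])
  qed
  also have "mat_star M * (mat_star ?Q * Z) = Z * (M * ?Q)"
    unfolding pCons
    using M Z comm assoc_mult_mat[of "mat_star M" n n Z n ?Q n] assoc_mult_mat[of Z n n M n ?Q n] by simp
  also have "nc_const c \<cdot>\<^sub>m Z + Z * (M * ?Q) = Z * mat_poly n M (pCons c q)"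
  proof -
    have "M * ?Q \<in> carrier_mat n n"
      by (intro mult_carrier_mat[of _ n n] M mat_poly_carrier)
    then have "Z * (nc_const c \<cdot>\<^sub>m 1\<^sub>m n + M * ?Q) = Z * (nc_const c \<cdot>\<^sub>m 1\<^sub>m n) + Z * (M * ?Q)"
      by (intro mult_add_distrib_mat[OF Z]) auto
    then show ?thesis
      using mult_const_smult[OF Z, of "1\<^sub>m n" n c] Z by (simp add: mat_poly_pCons)
  qed
  finally show ?case .
qed

end

lemma square_add:
  fixes b c t :: "'a :: comm_ring_1"
  shows "(b + c * t) * (b + c * t) = b * b + t * (2 * c * b) + c * c * (t * t)"
  by (simp add: algebra_simps)

text \<open>A truncated power series for \<open>sqrt (1 - t)\<close>, by undetermined coefficients: if \<open>b\<^sup>2 = 1 - t + t\<^sup>K r\<close> and \<open>b(0) = 1\<close>,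
  the correction \<open>b + c t\<^sup>K\<close> changes the square by \<open>2 c t\<^sup>K\<close> up to higher order, so \<open>c = - r(0) / 2\<close>
  raises the order of the error.\<close>

lemma sqrt_one_minus_truncated:
  "\<exists>b r. b * b = [:1, -1:] + monom 1 K * (r :: real poly)"
proof -
  have "\<exists>b r. poly b 0 = 1 \<and> b * b = [:1, -1:] + [:0, 1:] ^ Suc K * (r :: real poly)"
  proof (induction K)
    case 0
    have "1 * 1 = [:1, -1:] + [:0, 1:] ^ Suc 0 * (1 :: real poly)" by (simp add: one_pCons)
    then show ?case by (intro exI[of _ 1]) auto
  next
    case (Suc K)
    define t where "t = [:0, 1::real:] ^ Suc K"
    from Suc obtain b r where b: "poly b 0 = 1" "b * b = [:1, -1:] + t * r"
      unfolding t_def by blast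
    define c where "c = [:- poly r 0 / 2:]"
    have "poly (r + 2 * c * b) 0 = 0" using b(1) by (simp add: c_def)
    then obtain s where s: "r + 2 * c * b = [:0, 1:] * s"
      by (metis dvdE minus_zero poly_eq_0_iff_dvd)
    have "(b + c * t) * (b + c * t) = b * b + t * (2 * c * b) + c * c * (t * t)"
      by (rule square_add)
    also have "\<dots> = [:1, -1:] + t * (r + 2 * c * b) + c * c * (t * t)"
      unfolding b(2) by (simp only: distrib_left add.assoc)
    also have "\<dots> = [:1, -1:] + t * ([:0, 1:] * s) + c * c * (t * ([:0, 1:] * [:0, 1:] ^ K))"
      unfolding s by (simp only: t_def power_Suc)
    also have "\<dots> = [:1, -1:] + ([:0, 1:] * t) * (s + c * c * [:0, 1:] ^ K)"
      by (simp only: distrib_left mult.assoc mult.commute mult.left_commute add.assoc)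
    also have "[:0, 1:] * t = [:0, 1:] ^ Suc (Suc K)"
      by (simp only: t_def power_Suc)
    finally have "(b + c * t) * (b + c * t) = [:1, -1:] + [:0, 1:] ^ Suc (Suc K) * (s + c * c * [:0, 1:] ^ K)" .
    moreover have "poly (b + c * t) 0 = 1" using b(1) by (simp add: t_def)
    ultimately show ?case by blast
  qed
  then obtain b r where "b * b = [:1, -1:] + [:0, 1:] ^ Suc K * (r :: real poly)" by blast
  then have "b * b = [:1, -1:] + monom 1 K * ([:0, 1:] * r)"
    by (simp only: monom_altdef power_Suc smult_1_left mult.commute mult.left_commute)
  then show ?thesis by blast
qed

lemma inverse_one_minus_truncated: "\<exists>g. [:1, -1:] * g = 1 - monom (1::real) K"
proof -
  have "[:1, -1:] * (\<Sum>i<K. [:0, 1:] ^ i) = 1 - [:0, 1:: real:] ^ K"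
    using one_diff_power_eq[of "[:0, 1::real:]" K] by (simp add: one_pCons)
  then show ?thesis by (auto simp: monom_altdef)
qed

text \<open>For nilpotent \<open>M\<close> the truncated square root \<open>b\<close> of \<open>1 - t\<close> gives \<open>B = b(M)\<close> with \<open>B\<^sup>2 = 1 - M\<close>.
  Since \<open>Z\<close> intertwines, \<open>B\<^sup>T Z B = Z B\<^sup>2\<close>. The inverse is \<open>b(M) (1 + M + \<dots> + M\<^bsup>K-1\<^esup>)\<close>, again a polynomial
  in \<open>M\<close>.\<close>

lemma mat_sqrt:
  fixes Z M :: "('v, real) ncpoly mat"
  assumes M: "M \<in> carrier_mat n n" and Z: "Z \<in> carrier_mat n n"
    and comm: "mat_star M * Z = Z * M" and nil: "mat_poly n M (monom 1 K) = 0\<^sub>m n n"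
  shows "\<exists>B\<in>carrier_mat n n. \<exists>C\<in>carrier_mat n n. B * B = 1\<^sub>m n - M \<and>
    mat_star B * Z * B = Z * (1\<^sub>m n - M) \<and> B * C = 1\<^sub>m n \<and> C * B = 1\<^sub>m n"
proof -
  obtain b r where b: "b * b = [:1, -1:] + monom 1 K * (r :: real poly)"
    using sqrt_one_minus_truncated by blast
  obtain g where g: "[:1, -1:] * g = 1 - monom (1::real) K"
    using inverse_one_minus_truncated by blast
  let ?P = "mat_poly n M"
  note [simp] = mat_poly_carrier[OF M]
  have trunc: "?P (p + monom 1 K * q) = ?P p" for p q
    by (simp add: mat_poly_add[OF M] mat_poly_mult[OF M] nil left_mult_zero_mat[OF mat_poly_carrier[OF M]]
      right_add_zero_mat[OF mat_poly_carrier[OF M]])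
  have A: "?P [:1, -1:] = 1\<^sub>m n - M"
  proof -
    have "?P ([:1, -1:] + [:0, 1:]) = ?P 1" by (simp add: one_pCons)
    then have "?P [:1, -1:] + M = 1\<^sub>m n" using M by (simp only: mat_poly_add[OF M] mat_poly_X[OF M] mat_poly_1[OF M])
    moreover have "?P [:1, -1:] = (?P [:1, -1:] + M) - M"
      by (rule eq_matI) (use M mat_poly_carrier[OF M, of "[:1, -1:]"] in auto)
    ultimately show ?thesis by simp
  qed
  have BB: "?P b * ?P b = 1\<^sub>m n - M"
    unfolding mat_poly_mult[OF M, symmetric] b trunc A ..
  \<comment> \<open>\<open>B\<^sup>2 = 1 - M\<close> has the geometric series \<open>g(M)\<close> as inverse, so \<open>B g(M)\<close> inverts \<open>B\<close>.\<close>
  have "b * (b * g) = [:1, -1:] * g + monom 1 K * (r * g)"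
    by (simp only: b distrib_right mult.assoc flip: mult.assoc[of b b g])
  also have "\<dots> = 1 + monom 1 K * (r * g - 1)"
    unfolding g by (simp add: right_diff_distrib)
  finally have "b * (b * g) = 1 + monom 1 K * (r * g - 1)" .
  then have "?P b * ?P (b * g) = 1\<^sub>m n" and "?P (b * g) * ?P b = 1\<^sub>m n"
    using trunc[of 1] by (simp_all add: mat_poly_1[OF M] mult.commute[of _ b] flip: mat_poly_mult[OF M])
  moreover have "mat_star (?P b) * Z * ?P b = Z * (1\<^sub>m n - M)"
    unfolding mat_star_mat_poly[OF M Z comm] BB[symmetric] by (rule assoc_mult_mat[of _ n n _ n _ n]) (use Z in auto)
  ultimately show ?thesis
    using BB by (intro bexI[of _ "?P b"] bexI[of _ "?P (b * g)"]) auto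
qed

section \<open>Splitting off the first x\<close>

text \<open>The initial segments of words that end with the first \<open>x\<close>. Each word containing an \<open>x\<close> has exactly
  one of them as a prefix.\<close>

definition x_step :: "'g ax list \<Rightarrow> bool" where
  "x_step s \<longleftrightarrow> (\<exists>m k. s = m @ [X_var k] \<and> (\<forall>v\<in>set m. \<not> is_x v))"

lemma xdeg_x_step: "x_step s \<Longrightarrow> xdeg s = 1"
  by (auto simp: x_step_def)

lemma x_step_unique:
  assumes "x_step s" "x_step s'" "s @ y = s' @ y'"
  shows "s = s' \<and> y = y'"
proof -
  \<comment> \<open>A step is recovered from \<open>s @ y\<close> as the prefix up to and including the first \<open>x\<close>.\<close>
  have *: "s = take (Suc (length (takeWhile (Not \<circ> is_x) (s @ y)))) (s @ y)" if s: "x_step s" for s y :: "'a ax list"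
  proof -
    obtain m k where m: "s = m @ [X_var k]" "\<forall>v\<in>set m. \<not> is_x v"
      using s unfolding x_step_def by blast
    then have "takeWhile (Not \<circ> is_x) (s @ y) = m"
      by (simp add: takeWhile_append)
    then show ?thesis using m by simp
  qed
  have "s = s'" using *[OF assms(1), of y] *[OF assms(2), of y'] assms(3) by metis
  then show ?thesis using assms(3) by simp
qed

lemma x_step_exists:
  assumes "\<exists>v\<in>set z. is_x v"
  shows "\<exists>s y. x_step s \<and> z = s @ y"
proof -
  obtain m v y where z: "z = m @ v # y" "is_x v" "\<forall>v\<in>set m. \<not> is_x v"
    using split_list_first_prop[OF assms] by blast
  then obtain k where "v = X_var k" by (cases v) auto
  then show ?thesis
    using z by (intro exI[of _ "m @ [X_var k]"] exI[of _ y]) (auto simp: x_step_def)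
qed

text \<open>The entry for \<open>(d, e)\<close> is the word \<open>s\<close> if \<open>e = s\<^sup>T d\<close> for some step \<open>s\<close>. The word \<open>s\<close> can only be
  the reverse of what \<open>e\<close> has in front of its final segment of the length of \<open>d\<close>.\<close>

definition step_entry :: "'g ax list \<Rightarrow> 'g ax list \<Rightarrow> ('g ax, real) ncpoly" where
  "step_entry d e = (let s = rev (take (length e - length d) e) in
     if x_step s \<and> e = rev s @ d then nc_monom s else 0)"

lemma step_entry_append: "x_step s \<Longrightarrow> step_entry d (rev s @ d) = nc_monom s"
  by (simp add: step_entry_def)

lemma step_entry_eq_0:
  assumes "\<And>s. x_step s \<Longrightarrow> e \<noteq> rev s @ d"
  shows "step_entry d e = 0"
  using assms[of "rev (take (length e - length d) e)"] by (auto simp: step_entry_def Let_def)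

lemma lookup_step_entry_mult:
  assumes "x_step s"
  shows "Poly_Mapping.lookup (step_entry d e * q) (s @ y)
    = (if e = rev s @ d then Poly_Mapping.lookup q y else 0)"
proof (cases "\<exists>t. x_step t \<and> e = rev t @ d")
  case True
  then obtain t where t: "x_step t" "e = rev t @ d" by blast
  show ?thesis
  proof (cases "t = s")
    case False
    then have "s @ y \<noteq> t @ w" for w using x_step_unique[OF assms t(1)] by blast
    then show ?thesis
      using False t by (simp add: step_entry_append lookup_nc_monom_mult(2))
  qed (use t in \<open>simp add: step_entry_append lookup_nc_monom_mult(1)\<close>)
next
  case False
  then show ?thesis using assms by (auto simp: step_entry_eq_0)
qed

lemma lookup_step_entry_mult_a_word:
  assumes "\<forall>v\<in>set z. \<not> is_x v"
  shows "Poly_Mapping.lookup (step_entry d e * q) z = 0"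
proof (cases "\<exists>t. x_step t \<and> e = rev t @ d")
  case True
  then obtain t where t: "x_step t" "e = rev t @ d" by blast
  then have "z \<noteq> t @ w" for w using assms by (auto simp: x_step_def)
  then show ?thesis using t by (simp add: step_entry_append lookup_nc_monom_mult(2))
qed (auto simp: step_entry_eq_0)

definition border_indices :: "nat \<Rightarrow> nat \<Rightarrow> 'g ax list set" where
  "border_indices da dx = {X_var k # u | k u. xdeg u + 2 \<le> dx \<and> adeg u \<le> da}"

lemma erased_border:
  assumes "is_border da dx (ws :: 'g axh list list)"
  shows "distinct (map (map erase) ws)" and "set (map (map erase) ws) = border_indices da dx"
proof -
  note ws = border_list[OF assms]
  have erase_AX: "map erase (map AX_var z) = z" for z :: "'g ax list"
    by (induction z) auto
  have "inj_on (map erase) (set ws)"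
    unfolding ws(2) by (rule inj_onI) (auto simp del: map_map simp: erase_AX)
  then show "distinct (map (map erase) ws)"
    using ws(1) by (simp add: distinct_map)
  show "set (map (map erase) ws) = border_indices da dx"
  proof (intro equalityI subsetI)
    fix e :: "'g ax list" assume "e \<in> set (map (map erase) ws)"
    then obtain k u where "e = map erase (H_var k # map AX_var u)" "xdeg u + 2 \<le> dx" "adeg u \<le> da"
      using ws(2) by auto
    then show "e \<in> border_indices da dx"
      unfolding border_indices_def by (auto simp del: map_map simp: erase_AX)
  next
    fix e :: "'g ax list" assume "e \<in> border_indices da dx"
    then obtain k u where e: "e = X_var k # u" "xdeg u + 2 \<le> dx" "adeg u \<le> da"
      unfolding border_indices_def by blast
    then have "H_var k # map AX_var u \<in> set ws" unfolding ws(2) by blast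
    moreover have "e = map erase (H_var k # map AX_var u)"
      by (simp del: map_map add: e erase_AX)
    ultimately show "e \<in> set (map (map erase) ws)" by (simp del: list.map)
  qed
qed

definition middle_mat :: "('g ax, real) ncpoly \<Rightarrow> 'g ax list list \<Rightarrow> ('g ax, real) ncpoly mat" where
  "middle_mat p es = mat (length es) (length es) (\<lambda>(i, j). middle_entry p (es ! i) (es ! j))"

definition step_mat :: "'g ax list list \<Rightarrow> ('g ax, real) ncpoly mat" where
  "step_mat es = mat (length es) (length es) (\<lambda>(i, j). step_entry (es ! i) (es ! j))"

text \<open>The identity \<open>Z = Z(a,0) + N Z\<close>. A word \<open>z\<close> without \<open>x\<close> is seen by \<open>Z(a,0)\<close> and not by \<open>N Z\<close>,
  every word of which contains an \<open>x\<close>. Otherwise \<open>z = s y\<close> with a step \<open>s\<close>, and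
  \<open>d\<^sup>T z e = (s\<^sup>T d)\<^sup>T y e\<close>: the coefficient of \<open>z\<close> in entry \<open>(d, e)\<close> of \<open>Z\<close> equals that of \<open>y\<close> in entry
  \<open>(s\<^sup>T d, e)\<close>. If \<open>s\<^sup>T d\<close> is not a row index, its degrees are too large for \<open>d\<^sup>T z e\<close> to occur in \<open>p\<close>,
  and both sides vanish.\<close>

lemma middle_mat_step:
  fixes p :: "('g ax, real) ncpoly"
  assumes es: "distinct es" "set es = border_indices (nc_degree is_a p) (nc_degree is_x p)"
  shows "middle_mat p es = map_mat x_zero (middle_mat p es) + step_mat es * middle_mat p es"
proof (rule eq_matI)
  let ?n = "length es" and ?L = "Poly_Mapping.lookup"
  fix i j
  assume "i < dim_row (map_mat x_zero (middle_mat p es) + step_mat es * middle_mat p es)"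
    and "j < dim_col (map_mat x_zero (middle_mat p es) + step_mat es * middle_mat p es)"
  then have ij: "i < ?n" "j < ?n" by (simp_all add: step_mat_def middle_mat_def)
  let ?d = "es ! i" and ?e = "es ! j"
  have "?L (middle_entry p ?d ?e) z
     = ?L (x_zero (middle_entry p ?d ?e)) z + (\<Sum>l<?n. ?L (step_entry ?d (es ! l) * middle_entry p (es ! l) ?e) z)" for z
  proof (cases "\<exists>v\<in>set z. is_x v")
    case False
    then show ?thesis by (simp add: lookup_x_zero lookup_step_entry_mult_a_word)
  next
    case True
    then obtain s y where s: "x_step s" and z: "z = s @ y" using x_step_exists by blast
    let ?f = "rev s @ ?d"
    have shift: "?L (middle_entry p ?f ?e) y = ?L (middle_entry p ?d ?e) z"
      by (simp add: lookup_middle_entry z)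
    have "(\<Sum>l<?n. ?L (step_entry ?d (es ! l) * middle_entry p (es ! l) ?e) z)
        = (\<Sum>l<?n. if es ! l = ?f then ?L (middle_entry p ?d ?e) z else 0)"
      unfolding z using shift by (intro sum.cong) (auto simp: lookup_step_entry_mult[OF s] z)
    also have "\<dots> = ?L (middle_entry p ?d ?e) z"
    proof (cases "?f \<in> set es")
      case True
      then obtain l where l: "l < ?n" "es ! l = ?f" by (auto simp: in_set_conv_nth)
      then have "es ! l' = ?f \<longleftrightarrow> l' = l" if "l' < ?n" for l'
        using es(1) that nth_eq_iff_index_eq[of es l' l] by auto
      then have "(\<Sum>l'<?n. if es ! l' = ?f then ?L (middle_entry p ?d ?e) z else 0)
        = (\<Sum>l'<?n. if l' = l then ?L (middle_entry p ?d ?e) z else 0)"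
        by (intro sum.cong) auto
      then show ?thesis using l by simp
    next
      case False
      have "?L (middle_entry p ?d ?e) z = 0"
      proof (rule ccontr)
        assume "?L (middle_entry p ?d ?e) z \<noteq> 0"
        then have "rev ?d @ z @ ?e \<in> Poly_Mapping.keys p"
          by (simp add: lookup_middle_entry in_keys_iff)
        then have deg: "length (filter P (rev ?d @ z @ ?e)) \<le> nc_degree P p" for P
          by (rule length_filter_le_nc_degree)
        obtain k u where d: "?d = X_var k # u"
          using nth_mem[OF ij(1)] es(2) unfolding border_indices_def by blast
        obtain l v where e: "?e = X_var l # v"
          using nth_mem[OF ij(2)] es(2) unfolding border_indices_def by blast
        obtain m q where m: "s = m @ [X_var q]" using s unfolding x_step_def by blast
        \<comment> \<open>The last letter of \<open>s\<close> becomes the leading \<open>x\<close> of the index \<open>s\<^sup>T d\<close>, and \<open>e\<close> contributes at least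
          one more \<open>x\<close>: together they account for the 2.\<close>
        have "xdeg (rev m @ ?d) + 2 \<le> nc_degree is_x p" "adeg (rev m @ ?d) \<le> nc_degree is_a p"
          using deg[of is_x] deg[of is_a] by (auto simp: d e m z simp flip: rev_filter)
        then have "?f \<in> border_indices (nc_degree is_a p) (nc_degree is_x p)"
          unfolding border_indices_def m by auto
        then show False using False es(2) by simp
      qed
      then show ?thesis by (simp only: if_cancel sum.neutral_const)
    qed
    finally show ?thesis using True by (simp add: lookup_x_zero)
  qed
  then show "middle_mat p es $$ (i, j)
      = (map_mat x_zero (middle_mat p es) + step_mat es * middle_mat p es) $$ (i, j)"
    using ij by (intro poly_mapping_eqI)
      (simp add: middle_mat_def step_mat_def scalar_prod_def lookup_add lookup_sum lessThan_atLeast0)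
qed (simp_all add: middle_mat_def step_mat_def)

text \<open>The words \<open>d\<^sup>T z e\<close> and \<open>e\<^sup>T z\<^sup>T d\<close> are transposes of each other, hence have the same coefficient in
  a symmetric \<open>p\<close>.\<close>

lemma middle_mat_symmetric:
  assumes "nc_symmetric p"
  shows "mat_star (middle_mat p es) = middle_mat p es"
    and "mat_star (map_mat x_zero (middle_mat p es)) = map_mat x_zero (middle_mat p es)"
proof -
  have p: "Poly_Mapping.lookup p (rev w) = Poly_Mapping.lookup p w" for w
    using assms lookup_nc_star[of p w] by (simp add: nc_symmetric_def)
  have 1: "nc_star (middle_entry p e d) = middle_entry p d e" for d e
  proof (rule poly_mapping_eqI)
    fix z
    show "Poly_Mapping.lookup (nc_star (middle_entry p e d)) z = Poly_Mapping.lookup (middle_entry p d e) z"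
      using p[of "rev d @ z @ e"] by (simp add: lookup_nc_star lookup_middle_entry)
  qed
  have 2: "nc_star (x_zero q) = x_zero (nc_star q)" for q :: "('a ax, real) ncpoly"
    by (rule poly_mapping_eqI) (simp add: lookup_nc_star lookup_x_zero)
  show "mat_star (middle_mat p es) = middle_mat p es"
    and "mat_star (map_mat x_zero (middle_mat p es)) = map_mat x_zero (middle_mat p es)"
    by (auto intro!: eq_matI simp: mat_star_def middle_mat_def 1 2)
qed

lemma mat_star_add:
  fixes P Q :: "('v, 'r::comm_monoid_add) ncpoly mat"
  assumes "P \<in> carrier_mat n m" "Q \<in> carrier_mat n m"
  shows "mat_star (P + Q) = mat_star P + mat_star Q"
  by (rule eq_matI) (use assms in \<open>auto simp: mat_star_def nc_star_simps\<close>)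

text \<open>A nonzero entry of \<open>N\<^sup>T\<close> leads from a column to a row with exactly one more \<open>x\<close>, so a nonzero entry
  of its \<open>k\<close>-th power leads to one with \<open>k\<close> more, while the number of \<open>x\<close> in the indices is bounded.\<close>

lemma step_mat_nilpotent:
  assumes "\<And>e. e \<in> set es \<Longrightarrow> xdeg e < K"
  shows "mat_poly (length es) (mat_star (step_mat es)) (monom 1 K) = 0\<^sub>m (length es) (length es)"
proof -
  let ?n = "length es" and ?M = "mat_star (step_mat es)"
  have M: "?M \<in> carrier_mat ?n ?n" by (simp add: mat_star_def step_mat_def)
  note dims = carrier_matD[OF mat_poly_carrier[OF M]] carrier_matD[OF M]
  have M0: "?M $$ (i, j) = 0" if ij: "i < ?n" "j < ?n" and deg: "xdeg (es ! i) \<noteq> Suc (xdeg (es ! j))" for i j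
  proof -
    have "step_entry (es ! j) (es ! i) = 0"
    proof (rule step_entry_eq_0)
      show "es ! i \<noteq> rev s @ es ! j" if "x_step s" for s
        using xdeg_x_step[OF that] deg by (auto simp flip: rev_filter)
    qed
    then show ?thesis using ij by (simp add: mat_star_def step_mat_def nc_star_simps)
  qed
  have zero: "mat_poly ?n ?M (monom 1 k) $$ (i, j) = 0"
    if "i < ?n" "j < ?n" "xdeg (es ! i) < xdeg (es ! j) + k" for i j k
    using that
  proof (induction k arbitrary: i)
    case 0
    then have "i \<noteq> j" by auto
    then show ?case using 0 by (simp add: mat_poly_1[OF M])
  next
    case (Suc k)
    have "mat_poly ?n ?M (monom 1 (Suc k)) = ?M * mat_poly ?n ?M (monom 1 k)"
      using mat_poly_mult[OF M, of "[:0, 1:]" "monom 1 k"] mat_poly_X[OF M] by (simp add: monom_Suc)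
    also have "\<dots> $$ (i, j) = (\<Sum>l<?n. ?M $$ (i, l) * mat_poly ?n ?M (monom 1 k) $$ (l, j))"
      using Suc.prems by (simp add: dims scalar_prod_def lessThan_atLeast0)
    also have "\<dots> = 0"
    proof (intro sum.neutral ballI)
      fix l assume "l \<in> {..<?n}"
      then show "?M $$ (i, l) * mat_poly ?n ?M (monom 1 k) $$ (l, j) = 0"
        using M0[of i l] Suc.IH[of l] Suc.prems by (cases "xdeg (es ! i) = Suc (xdeg (es ! l))") auto
    qed
    finally show ?case .
  qed
  show ?thesis
  proof (rule eq_matI)
    fix i j assume "i < dim_row (0\<^sub>m ?n ?n :: ('a ax, real) ncpoly mat)" "j < dim_col (0\<^sub>m ?n ?n :: ('a ax, real) ncpoly mat)"
    then show "mat_poly ?n ?M (monom 1 K) $$ (i, j) = 0\<^sub>m ?n ?n $$ (i, j)"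
      using zero assms[of "es ! i"] by simp
  qed (simp_all add: dims)
qed


section \<open>Evaluation on tuples of matrices\<close>

lemma word_eval_append:
  assumes "\<And>v. \<sigma> v \<in> carrier_mat n n"
  shows "word_eval n \<sigma> w \<in> carrier_mat n n"
    and "word_eval n \<sigma> (u @ w) = word_eval n \<sigma> u * word_eval n \<sigma> w"
proof -
  have car: "word_eval n \<sigma> w \<in> carrier_mat n n" for w
    by (induction w) (use assms in \<open>auto simp: word_eval_def intro!: mult_carrier_mat\<close>)
  then show "word_eval n \<sigma> w \<in> carrier_mat n n" .
  show "word_eval n \<sigma> (u @ w) = word_eval n \<sigma> u * word_eval n \<sigma> w"
  proof (induction u)
    case Nil
    then show ?case using car[of w] by (simp add: word_eval_def)
  next
    case (Cons v u)
    then have "word_eval n \<sigma> ((v # u) @ w) = \<sigma> v * (word_eval n \<sigma> u * word_eval n \<sigma> w)"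
      by (simp add: word_eval_def)
    also have "\<dots> = word_eval n \<sigma> (v # u) * word_eval n \<sigma> w"
      using assoc_mult_mat[OF assms car car, of v u w] by (simp add: word_eval_def)
    finally show ?case .
  qed
qed

lemma nc_eval_carrier: "nc_eval n \<sigma> p \<in> carrier_mat n n"
  by (simp add: nc_eval_def)

lemma nc_eval_add: "nc_eval n \<sigma> (p + q) = nc_eval n \<sigma> p + nc_eval n \<sigma> q"
proof (rule eq_matI)
  fix i j assume "i < dim_row (nc_eval n \<sigma> p + nc_eval n \<sigma> q)" "j < dim_col (nc_eval n \<sigma> p + nc_eval n \<sigma> q)"
  then show "nc_eval n \<sigma> (p + q) $$ (i, j) = (nc_eval n \<sigma> p + nc_eval n \<sigma> q) $$ (i, j)"
    using setsum_keys_plus_distrib[of "\<lambda>w c. c * word_eval n \<sigma> w $$ (i, j)" p q]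
    by (simp add: nc_eval_def distrib_right)
qed (simp_all add: nc_eval_def)

lemma nc_eval_0: "nc_eval n \<sigma> 0 = 0\<^sub>m n n"
  by (rule eq_matI) (simp_all add: nc_eval_def)

lemma nc_eval_single:
  assumes "\<And>v. \<sigma> v \<in> carrier_mat n n"
  shows "nc_eval n \<sigma> (Poly_Mapping.single w c) = c \<cdot>\<^sub>m word_eval n \<sigma> w"
  by (rule eq_matI) (use word_eval_append(1)[where \<sigma> = \<sigma>, OF assms, of w] in \<open>auto simp: nc_eval_def\<close>)

lemma nc_eval_mult:
  assumes "\<And>v. \<sigma> v \<in> carrier_mat n n"
  shows "nc_eval n \<sigma> (p * q) = nc_eval n \<sigma> p * nc_eval n \<sigma> q"
proof (induction p rule: ncpoly_induct)
  case zero
  show ?case using nc_eval_carrier[of n \<sigma> q] by (simp add: nc_eval_0)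
next
  case (add p p')
  then show ?case
    using add_mult_distrib_mat[of "nc_eval n \<sigma> p" n n "nc_eval n \<sigma> p'" "nc_eval n \<sigma> q" n]
    by (simp add: distrib_right nc_eval_add nc_eval_carrier)
next
  case (single w c)
  let ?S = "Poly_Mapping.single w c"
  show ?case
  proof (induction q rule: ncpoly_induct)
    case zero
    show ?case using nc_eval_carrier[of n \<sigma> ?S] by (simp add: nc_eval_0)
  next
    case (add q q')
    then show ?case
      using mult_add_distrib_mat[of "nc_eval n \<sigma> ?S" n n "nc_eval n \<sigma> q" n "nc_eval n \<sigma> q'"]
      by (simp add: distrib_left nc_eval_add nc_eval_carrier)
  next
    case (single v d)
    have "nc_eval n \<sigma> (?S * Poly_Mapping.single v d) = (c * d) \<cdot>\<^sub>m (word_eval n \<sigma> w * word_eval n \<sigma> v)"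
      by (simp add: mult_single plus_list_def nc_eval_single assms word_eval_append)
    also have "\<dots> = (c \<cdot>\<^sub>m word_eval n \<sigma> w) * (d \<cdot>\<^sub>m word_eval n \<sigma> v)"
      using word_eval_append(1)[where \<sigma> = \<sigma>, OF assms, of w] word_eval_append(1)[where \<sigma> = \<sigma>, OF assms, of v]
      by (simp add: mult_smult_assoc_mat[of _ n n _ n] mult_smult_distrib[of _ n n _ n])
        (auto simp: smult_mat_def)
    finally show ?case by (simp add: nc_eval_single assms)
  qed
qed

lemma nc_eval_1: "nc_eval n \<sigma> 1 = 1\<^sub>m n"
  by (rule eq_matI) (simp_all add: nc_eval_def zero_list_def word_eval_def lookup_one)

lemma nc_eval_sum_index:
  assumes "i < n" "j < n"
  shows "nc_eval n \<sigma> (\<Sum>k\<in>S. f k) $$ (i, j) = (\<Sum>k\<in>S. nc_eval n \<sigma> (f k) $$ (i, j))"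
proof (induction S rule: infinite_finite_induct)
  case (insert x S)
  then show ?case
    using assms by (simp add: nc_eval_add nc_eval_carrier[THEN carrier_matD(1)] nc_eval_carrier[THEN carrier_matD(2)])
qed (use assms in \<open>simp_all add: nc_eval_0\<close>)

text \<open>Block multiplication: a summation index \<open>t < m * n\<close> of the product of the values splits into the
  block number \<open>t div n\<close> and the position \<open>t mod n\<close> within the block.\<close>

lemma nc_mat_eval_mult:
  assumes \<sigma>: "\<And>v. \<sigma> v \<in> carrier_mat n n"
    and P: "P \<in> carrier_mat r m" and Q: "Q \<in> carrier_mat m l"
  shows "nc_mat_eval n \<sigma> (P * Q) = nc_mat_eval n \<sigma> P * nc_mat_eval n \<sigma> Q"
proof (rule eq_matI)
  fix i j assume "i < dim_row (nc_mat_eval n \<sigma> P * nc_mat_eval n \<sigma> Q)"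
    and "j < dim_col (nc_mat_eval n \<sigma> P * nc_mat_eval n \<sigma> Q)"
  then have i: "i < r * n" and j: "j < l * n" using P Q by (auto simp: nc_mat_eval_def)
  have "n \<noteq> 0" using i by (cases n) auto
  then have ij: "i div n < r" "j div n < l" "i mod n < n" "j mod n < n"
    using i j by (auto simp: less_mult_imp_div_less)
  let ?E = "nc_eval n \<sigma>"
  note [simp] = nc_eval_carrier[of n \<sigma>, THEN carrier_matD(1)] nc_eval_carrier[of n \<sigma>, THEN carrier_matD(2)]
  have "nc_mat_eval n \<sigma> (P * Q) $$ (i, j)
     = ?E (\<Sum>k<m. P $$ (i div n, k) * Q $$ (k, j div n)) $$ (i mod n, j mod n)"
    using P Q i j ij by (simp add: nc_mat_eval_def scalar_prod_def lessThan_atLeast0)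
  also have "\<dots> = (\<Sum>k<m. (?E (P $$ (i div n, k)) * ?E (Q $$ (k, j div n))) $$ (i mod n, j mod n))"
    by (simp only: nc_eval_sum_index[OF ij(3,4)] nc_eval_mult[OF \<sigma>])
  also have "\<dots> = (\<Sum>k<m. \<Sum>s<n. ?E (P $$ (i div n, k)) $$ (i mod n, s) * ?E (Q $$ (k, j div n)) $$ (s, j mod n))"
    using ij by (simp add: scalar_prod_def lessThan_atLeast0)
  also have "\<dots> = (\<Sum>k<m. \<Sum>t\<in>{k * n..<k * n + n}.
      ?E (P $$ (i div n, t div n)) $$ (i mod n, t mod n) * ?E (Q $$ (t div n, j div n)) $$ (t mod n, j mod n))"
  proof (rule sum.cong[OF refl])
    fix k
    show "(\<Sum>s<n. ?E (P $$ (i div n, k)) $$ (i mod n, s) * ?E (Q $$ (k, j div n)) $$ (s, j mod n))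
      = (\<Sum>t\<in>{k * n..<k * n + n}.
      ?E (P $$ (i div n, t div n)) $$ (i mod n, t mod n) * ?E (Q $$ (t div n, j div n)) $$ (t mod n, j mod n))"
      using sum.shift_bounds_nat_ivl[of "\<lambda>t. ?E (P $$ (i div n, t div n)) $$ (i mod n, t mod n) * ?E (Q $$ (t div n, j div n)) $$ (t mod n, j mod n)" 0 "k * n" n]
      by (simp add: lessThan_atLeast0 add.commute[of _ n])
  qed
  also have "\<dots> = (\<Sum>t<m * n. ?E (P $$ (i div n, t div n)) $$ (i mod n, t mod n) * ?E (Q $$ (t div n, j div n)) $$ (t mod n, j mod n))"
    by (rule sum.nat_group)
  also have "\<dots> = (nc_mat_eval n \<sigma> P * nc_mat_eval n \<sigma> Q) $$ (i, j)"
    using P Q i j by (simp add: nc_mat_eval_def scalar_prod_def lessThan_atLeast0)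
  finally show "nc_mat_eval n \<sigma> (P * Q) $$ (i, j) = (nc_mat_eval n \<sigma> P * nc_mat_eval n \<sigma> Q) $$ (i, j)" .
qed (use P Q in \<open>simp_all add: nc_mat_eval_def\<close>)

lemma nc_mat_eval_1: "nc_mat_eval n \<sigma> (1\<^sub>m m) = 1\<^sub>m (m * n)"
proof (rule eq_matI)
  fix i j assume "i < dim_row (1\<^sub>m (m * n) :: real mat)" "j < dim_col (1\<^sub>m (m * n) :: real mat)"
  then have i: "i < m * n" and j: "j < m * n" by auto
  have "n \<noteq> 0" using i by (cases n) auto
  then have ij: "i div n < m" "j div n < m" "i mod n < n" "j mod n < n"
    using i j by (auto simp: less_mult_imp_div_less)
  have "i = j \<longleftrightarrow> i div n = j div n \<and> i mod n = j mod n" by (metis div_mod_decomp)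
  then show "nc_mat_eval n \<sigma> (1\<^sub>m m) $$ (i, j) = 1\<^sub>m (m * n) $$ (i, j)"
    using i j ij by (auto simp: nc_mat_eval_def nc_eval_1 nc_eval_0)
qed (simp_all add: nc_mat_eval_def)

lemma invertible_nc_mat_eval:
  assumes \<sigma>: "\<And>v. \<sigma> v \<in> carrier_mat n n"
    and B: "B \<in> carrier_mat m m" "C \<in> carrier_mat m m" and BC: "B * C = 1\<^sub>m m" "C * B = 1\<^sub>m m"
  shows "invertible_mat (nc_mat_eval n \<sigma> B)"
proof -
  have "nc_mat_eval n \<sigma> B * nc_mat_eval n \<sigma> C = 1\<^sub>m (m * n)"
    unfolding nc_mat_eval_mult[OF \<sigma> B, symmetric] BC by (rule nc_mat_eval_1)
  moreover have "nc_mat_eval n \<sigma> C * nc_mat_eval n \<sigma> B = 1\<^sub>m (m * n)"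
    unfolding nc_mat_eval_mult[OF \<sigma> B(2,1), symmetric] BC by (rule nc_mat_eval_1)
  ultimately show ?thesis
    using B unfolding invertible_mat_def inverts_mat_def square_mat.simps
    by (intro conjI exI[of _ "nc_mat_eval n \<sigma> C"]) (simp_all add: nc_mat_eval_def)
qed

section \<open>The congruence between the middle matrix and its value at x = 0\<close>

theorem theorem6p2:
  fixes p :: "('g::finite ax, real) ncpoly"
    and da dx :: nat
    and ws :: "'g axh list list"
    and Z Z0 :: "('g ax, real) ncpoly mat"
  assumes "nc_symmetric p"
    and "nc_degree is_a p = da"
    and "nc_degree is_x p = dx"
    and "dx \<ge> 2"
    and "is_border da dx ws"
    and "Z = middle_matrix ws p"
    and "Z0 = map_mat x_zero Z"
  shows "\<exists>A \<in> carrier_mat (length ws) (length ws). Z * A = Z0 \<and>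
           (\<exists>B \<in> carrier_mat (length ws) (length ws).
              B * B = A \<and>
              mat_star B * Z * B = Z0 \<and>
              invertible_mat B \<and>
              (\<forall>n. \<forall>(a, x) \<in> sym_tuples n. invertible_mat (nc_mat_eval n (ax_value a x) B)))"
proof -
  define es where "es = map (map erase) ws"
  define n where "n = length ws"
  have len: "length es = n" by (simp add: es_def n_def)
  note es = erased_border[OF assms(5), folded es_def]
  have Z_eq: "Z = middle_mat p es"
    unfolding assms(6) middle_mat_def using assms(2,3,5)
    by (subst middle_matrix_eq) (auto simp: es_def intro!: eq_matI)
  \<comment> \<open>\<open>N\<close> acts from the left; transposing its identity yields the factor \<open>1 - M\<close> on the right.\<close>
  let ?N = "step_mat es"
  let ?M = "mat_star ?N"
  have Z: "Z \<in> carrier_mat n n" and Z0: "Z0 \<in> carrier_mat n n" and N: "?N \<in> carrier_mat n n" and M: "?M \<in> carrier_mat n n"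
    by (simp_all add: Z_eq assms(7) middle_mat_def step_mat_def mat_star_def len)
  have NM: "mat_star ?M = ?N"
    by (rule eq_matI) (auto simp: mat_star_def nc_star_simps)
  have sym: "mat_star Z = Z" "mat_star Z0 = Z0"
    using middle_mat_symmetric[OF assms(1), of es] by (simp_all add: Z_eq assms(7))
  have ZN: "Z = Z0 + ?N * Z"
    unfolding assms(7) Z_eq by (rule middle_mat_step) (use es assms(2,3) in auto)
  have NZ_carrier: "?N * Z \<in> carrier_mat n n" and ZM_carrier: "Z * ?M \<in> carrier_mat n n"
    using N Z M by auto
  have "mat_star Z = mat_star Z0 + mat_star (?N * Z)"
    using ZN mat_star_add[OF Z0 NZ_carrier] by simp
  then have ZM: "Z = Z0 + Z * ?M"
    unfolding sym mat_star_mult[OF N Z] .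
  have cancel: "X = Z - Z0" if "Z = Z0 + X" "X \<in> carrier_mat n n" for X
    by (subst that(1), rule eq_matI) (use that(2) Z0 in auto)
  have comm: "mat_star ?M * Z = Z * ?M"
    unfolding NM using cancel[OF ZN NZ_carrier] cancel[OF ZM ZM_carrier] by simp
  have "xdeg e < dx" if "e \<in> set es" for e
    using that unfolding es(2) border_indices_def by auto
  then have nil: "mat_poly n ?M (monom 1 dx) = 0\<^sub>m n n"
    using step_mat_nilpotent[of es dx] len by simp
  let ?A = "1\<^sub>m n - ?M"
  have A: "?A \<in> carrier_mat n n" using M by (rule minus_carrier_mat)
  have ZA: "Z * ?A = Z0"
  proof -
    have "Z * ?A = Z - Z * ?M"
      using mult_minus_distrib_mat[OF Z one_carrier_mat M] Z by simp
    also have "\<dots> = Z0"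
      unfolding cancel[OF ZM ZM_carrier] by (rule eq_matI) (use Z Z0 in auto)
    finally show ?thesis .
  qed
  obtain B C where BC: "B \<in> carrier_mat n n" "C \<in> carrier_mat n n" "B * B = ?A"
      "mat_star B * Z * B = Z * ?A" "B * C = 1\<^sub>m n" "C * B = 1\<^sub>m n"
    using mat_sqrt[OF M Z comm nil] by blast
  have "invertible_mat B"
    using BC unfolding invertible_mat_def inverts_mat_def by auto
  moreover have "invertible_mat (nc_mat_eval r (ax_value a x) B)" if "(a, x) \<in> sym_tuples r" for r a x
  proof (rule invertible_nc_mat_eval)
    show "ax_value a x v \<in> carrier_mat r r" for v
      using that by (cases v) (auto simp: sym_tuples_def)
  qed (use BC in auto)
  ultimately show ?thesis
    unfolding n_def[symmetric] using A ZA BC by (intro bexI[of _ ?A] conjI bexI[of _ B]) auto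
qed

end
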